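(* Let $f:\mathbb{R}^D\to\mathbb{R}$ be continuous, attain its global minimum $f^*$, and have effective dimensionality $d_e\le d$. Let $\boldsymbol{A}$ be a $D\times d$ Gaussian matrix. Then, for any $\delta>0$, $$\mathbb{P}[(\mathrm{RP})\text{ is successful}]\;\ge\;\mathbb{P}\left[\chi^2_{d-d_e+1}\ge\frac{\min_{\boldsymbol{x}^*\in\mathcal{G}}\|\boldsymbol{x}^*\|_2^2}{\delta^2}\right],$$ where $(\mathrm{RP})$ is the reduced problem $\min_{\boldsymbol{y}} f(\boldsymbol{A}\boldsymbol{y})$ subject to $\boldsymbol{y}\in\mathcal{Y}=[-\delta,\delta]^d$, and $(\mathrm{RP})$ is called successful if there exists $\boldsymbol{y}^*\in\mathcal{Y}$ such that $f(\boldsymbol{A}\boldsymbol{y}^* )=f^*$.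
   Context: Effective dimensionality: $f:\mathbb{R}^D\to\mathbb{R}$ has effective dimensionality $d_e\le D$ if there is a linear subspace $\mathcal{T}\subseteq\mathbb{R}^D$ of dimension $d_e$ such that $f(\boldsymbol{x}_\top+\boldsymbol{x}_\perp)=f(\boldsymbol{x}_\top)$ for all $\boldsymbol{x}_\top\in\mathcal{T}$ and $\boldsymbol{x}_\perp\in\mathcal{T}^\perp$, and $d_e$ is the smallest integer with this property. $\mathcal{G}=\{\boldsymbol{x}\in\mathbb{R}^D: f(\boldsymbol{x})=f^*\}$ is the set of global minimizers, where $f^*=\min_{\boldsymbol{x}\in\mathbb{R}^D} f(\boldsymbol{x})$. A Gaussian matrix is a random matrix whose entries are independent standard normal random variables. $\chi^2_n$ denotes a chi-squared random variable with $n$ degrees of freedom. *)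

theory Defs
  imports "HOL-Probability.Probability"
begin

(* The minimum of g over S as an attained value: it is only meaningful when g has a minimizer
   on S (otherwise LEAST denotes an unspecified real number). *)
definition min_over :: "'a set \<Rightarrow> ('a \<Rightarrow> real) \<Rightarrow> real" where
  "min_over S g = (LEAST r. r \<in> g ` S)"

definition attains_global_min :: "('a \<Rightarrow> real) \<Rightarrow> bool" where
  "attains_global_min f \<longleftrightarrow> (\<exists>x. \<forall>y. f x \<le> f y)"

abbreviation global_min :: "('a \<Rightarrow> real) \<Rightarrow> real" where
  "global_min f \<equiv> min_over UNIV f"

definition global_minimizers :: "('a \<Rightarrow> real) \<Rightarrow> 'a set" where
  "global_minimizers f = {x. f x = global_min f}"

definition invariant_off_subspace_of_dim :: "('a::euclidean_space \<Rightarrow> real) \<Rightarrow> nat \<Rightarrow> bool" where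
  "invariant_off_subspace_of_dim f k \<longleftrightarrow>
     (\<exists>T. subspace T \<and> dim T = k \<and> (\<forall>x\<in>T. \<forall>z\<in>T\<^sup>\<bottom>. f (x + z) = f x))"

definition has_effective_dim :: "('a::euclidean_space \<Rightarrow> real) \<Rightarrow> nat \<Rightarrow> bool" where
  "has_effective_dim f k \<longleftrightarrow>
     invariant_off_subspace_of_dim f k \<and> (\<forall>j. invariant_off_subspace_of_dim f j \<longrightarrow> k \<le> j)"

(* A random matrix with D = CARD('n) rows and d = CARD('m) columns. *)
definition (in prob_space) gaussian_matrix :: "('a \<Rightarrow> real ^ 'm::finite ^ 'n::finite) \<Rightarrow> bool" where
  "gaussian_matrix A \<longleftrightarrow>
     indep_vars (\<lambda>_. borel) (\<lambda>(i, j) \<omega>. A \<omega> $ i $ j) UNIV \<and>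
     (\<forall>i j. distributed M lborel (\<lambda>\<omega>. A \<omega> $ i $ j) std_normal_density)"

(* The law of the sum of the squares of n independent standard normal variables. *)
definition chi_squared :: "nat \<Rightarrow> real measure" where
  "chi_squared n =
     distr (\<Pi>\<^sub>M i\<in>{..<n}. std_normal_distribution) borel (\<lambda>z. \<Sum>i<n. (z i)\<^sup>2)"

definition reduced_feasible :: "real \<Rightarrow> (real ^ 'm::finite) set" where
  "reduced_feasible \<delta> = {y. \<forall>j. y $ j \<in> {-\<delta>..\<delta>}}"

definition RP_successful ::
    "(real ^ 'n::finite \<Rightarrow> real) \<Rightarrow> real ^ 'm::finite ^ 'n \<Rightarrow> real \<Rightarrow> bool" where
  "RP_successful f B \<delta> \<longleftrightarrow> (\<exists>y\<in>reduced_feasible \<delta>. f (B *v y) = global_min f)"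

end

theory Submission
  imports Defs
begin

text \<open>Let \<open>x\<close> be a global minimizer of least norm; it lies in the effective subspace \<open>T\<close>. Every
  \<open>y\<close> with \<open>A y \<in> x + T\<^sup>\<bottom>\<close> satisfies \<open>f (A y) = f x\<close>, and it is feasible once
  \<open>norm y \<le> \<delta>\<close>. By rotation invariance of the Gaussian distribution we may assume
  \<open>x = c e\<close> with \<open>e\<close> a coordinate vector. Let \<open>b\<close> be the corresponding row of \<open>A\<close> and fix the
  other rows. The \<open>y\<close> for which \<open>A y\<close> is orthogonal to \<open>T \<inter> e\<^sup>\<bottom>\<close> form a subspace \<open>W\<close> that
  depends only on the other rows and has dimension at least \<open>d - d\<^sub>e + 1\<close>. If \<open>q b\<close> is the projection
  of \<open>b\<close> to a \<open>(d - d\<^sub>e + 1)\<close>-dimensional subspace of \<open>W\<close>, then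
  \<open>y = (c / (norm (q b))\<^sup>2) q b\<close> solves the problem whenever \<open>(norm (q b))\<^sup>2 \<ge> c\<^sup>2 / \<delta>\<^sup>2\<close>. As
  \<open>b\<close> is Gaussian and independent of \<open>W\<close>, this has the required conditional probability for
  every choice of the other rows, even when these are linearly dependent.\<close>

section \<open>The standard Gaussian measure and its rotation invariance\<close>

text \<open>A density with respect to Lebesgue measure makes rotation invariance accessible. The
  description by a product of standard normal laws follows in
  \<open>gaussian_vec_eq_distr_PiM\<close>.\<close>

definition gaussian_vec :: "(real ^ 'i::finite) measure" where
  "gaussian_vec = density lborel (\<lambda>x. \<Prod>i\<in>UNIV. ennreal (std_normal_density (x $ i)))"

lemma space_gaussian_vec [simp]: "space gaussian_vec = UNIV"
  and sets_gaussian_vec [simp, measurable_cong]: "sets gaussian_vec = sets borel"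
  by (simp_all add: gaussian_vec_def)

lemma borel_measurable_orthogonal_transformation:
  fixes Q :: "'a::euclidean_space \<Rightarrow> 'a"
  assumes "orthogonal_transformation Q"
  shows "Q \<in> borel_measurable borel"
  by (intro borel_measurable_continuous_onI linear_continuous_on linear_conv_bounded_linear[THEN iffD1]
      orthogonal_transformation_linear assms)

text \<open>The change-of-variables theorem for linear maps in HOL-Analysis requires a well-ordered index
  type. Instead: balls are mapped to balls of the same radius, and by Vitali's covering theorem an
  open set is, up to a null set, a countable disjoint union of balls.\<close>

lemma distr_lborel_orthogonal_transformation:
  fixes Q :: "'a::euclidean_space \<Rightarrow> 'a"
  assumes Q: "orthogonal_transformation Q"
  shows "distr lborel borel Q = lborel"
proof (rule sym, rule lborel_eqI)
  fix l u :: 'a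
  assume lu: "\<And>b. b \<in> Basis \<Longrightarrow> l \<bullet> b \<le> u \<bullet> b"
  have meas [measurable]: "Q \<in> borel_measurable borel"
    by (rule borel_measurable_orthogonal_transformation[OF Q])
  have bij: "bij Q"
    using Q by (simp add: orthogonal_transformation_bij)
  have invQ: "orthogonal_transformation (inv Q)"
    using Q by (rule orthogonal_transformation_inv)
  define S where "S = box l u"
  \<comment> \<open>Balls are encoded by centre and radius. Vitali's theorem asks that every point
    of \<open>S\<close> lie in members of arbitrarily small radius; the fact \<open>K\<close> below
    provides this.\<close>
  define K where "K = {(a, r). 0 < r \<and> ball a r \<subseteq> S}"
  have S: "open S" by (simp add: S_def open_box)
  have K: "\<exists>i. i \<in> K \<and> x \<in> ball (fst i) (snd i) \<and> snd i < d" if x: "x \<in> S" and d: "0 < d" for x d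
  proof -
    obtain e where "e > 0" "ball x e \<subseteq> S" using S x by (meson openE)
    then have "(x, min e (d / 2)) \<in> K" using d by (auto simp: K_def)
    then show ?thesis using \<open>e > 0\<close> d
      by (intro exI[of _ "(x, min e (d / 2))"]) auto
  qed
  obtain C where C: "countable C" "C \<subseteq> K"
    and disj: "pairwise (\<lambda>i j. disjnt (ball (fst i) (snd i)) (ball (fst j) (snd j))) C"
    and neg: "negligible (S - (\<Union>i\<in>C. ball (fst i) (snd i)))"
    by (rule Vitali_covering_theorem_balls[where S = S and K = K and a = fst and r = snd, OF K]) auto
  define U where "U = (\<Union>i\<in>C. ball (fst i) (snd i))"
  have U: "open U" "U \<subseteq> S"
    using C(2) by (force simp: U_def K_def)+
  have [measurable]: "S \<in> sets borel" "U \<in> sets borel"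
    using S U by auto
  have ball: "emeasure (distr lborel borel Q) (ball a r) = emeasure lborel (ball a r)" if "0 < r" for a r
  proof -
    have "Q -` ball a r = inv Q ` ball a r"
      using bij by (simp add: bij_vimage_eq_inv_image)
    also have "\<dots> = ball (inv Q a) r"
      by (rule image_orthogonal_transformation_ball[OF invQ])
    finally show ?thesis
      using that by (simp add: emeasure_distr emeasure_ball)
  qed
  have null: "emeasure lborel (S - U) = 0" "emeasure (distr lborel borel Q) (S - U) = 0"
  proof -
    \<comment> \<open>\<open>inv Q\<close> is an isometry, hence 1-Lipschitz, and such a map of the
      space to itself preserves negligible sets.\<close>
    have "negligible (inv Q ` (S - U))"
      using neg invQ unfolding U_def
      by (intro negligible_locally_Lipschitz_image)
        (auto intro!: exI[of _ UNIV] exI[of _ 1] simp: orthogonal_transformation_linear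
          linear_diff[symmetric] orthogonal_transformation_norm)
    then have "negligible (Q -` (S - U))"
      using bij by (simp add: bij_vimage_eq_inv_image)
    moreover have "Q -` (S - U) \<in> sets borel"
      using measurable_sets[OF meas, of "S - U"] by simp
    ultimately show "emeasure (distr lborel borel Q) (S - U) = 0"
      by (simp add: emeasure_distr negligible_iff_null_sets null_sets_completion_iff null_sets_def)
    show "emeasure lborel (S - U) = 0"
      using neg by (simp add: U_def[symmetric] negligible_iff_null_sets null_sets_completion_iff null_sets_def)
  qed
  have disj': "disjoint_family_on (\<lambda>i. ball (fst i) (snd i)) C"
    using disj by (auto simp: disjoint_family_on_def pairwise_def disjnt_def)
  have *: "emeasure M S = emeasure M U" if "sets M = sets borel" "emeasure M (S - U) = 0" for M :: "'a measure"
  proof -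
    have "emeasure M (U \<union> (S - U)) = emeasure M U + emeasure M (S - U)"
      by (intro plus_emeasure[symmetric]) (auto simp: that)
    then show ?thesis using U(2) that by (simp add: Un_absorb1)
  qed
  \<comment> \<open>Countable additivity over the disjoint balls reduces equality on
    \<open>U\<close>, and by \<open>null\<close> also on \<open>S\<close>, to equality on single
    balls.\<close>
  have "emeasure (distr lborel borel Q) U = (\<integral>\<^sup>+i. emeasure (distr lborel borel Q) (ball (fst i) (snd i)) \<partial>count_space C)"
    unfolding U_def by (rule emeasure_UN_countable[OF _ C(1) disj']) auto
  also have "\<dots> = (\<integral>\<^sup>+i. emeasure lborel (ball (fst i) (snd i)) \<partial>count_space C)"
    using C(2) by (intro nn_integral_cong ball) (auto simp: K_def)
  also have "\<dots> = emeasure lborel U"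
    unfolding U_def by (rule emeasure_UN_countable[OF _ C(1) disj', symmetric]) auto
  finally have "emeasure (distr lborel borel Q) S = emeasure lborel S"
    using *[of "distr lborel borel Q"] *[of lborel] null by simp
  then show "emeasure (distr lborel borel Q) (box l u) = ennreal (\<Prod>b\<in>Basis. (u - l) \<bullet> b)"
    using lu by (simp add: emeasure_lborel_box S_def)
qed simp

text \<open>The density is a function of \<open>x \<bullet> x\<close> alone, so \<open>Q\<close>
  preserves it as well as the Lebesgue measure.\<close>

lemma distr_gaussian_vec_orthogonal_transformation:
  fixes Q :: "real ^ 'i::finite \<Rightarrow> real ^ 'i"
  assumes Q: "orthogonal_transformation Q"
  shows "distr gaussian_vec borel Q = gaussian_vec"
proof -
  define g :: "real ^ 'i \<Rightarrow> ennreal" where "g = (\<lambda>x. \<Prod>i\<in>UNIV. ennreal (std_normal_density (x $ i)))"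
  have meas: "Q \<in> borel_measurable borel"
    by (rule borel_measurable_orthogonal_transformation[OF Q])
  have g: "g x = ennreal ((1 / sqrt (2 * pi)) ^ CARD('i) * exp (- (x \<bullet> x) / 2))" for x
  proof -
    have "(\<Prod>i\<in>UNIV. std_normal_density (x $ i)) =
      (1 / sqrt (2 * pi)) ^ CARD('i) * exp (\<Sum>i\<in>UNIV. - (x $ i)\<^sup>2 / 2)"
      by (simp add: std_normal_density_def prod.distrib exp_sum prod_dividef power_divide)
    also have "(\<Sum>i\<in>UNIV. - (x $ i)\<^sup>2 / 2) = - (x \<bullet> x) / 2"
      by (simp add: inner_vec_def power2_eq_square sum_negf sum_divide_distrib)
    finally show ?thesis
      by (simp add: g_def prod_ennreal)
  qed
  have gQ: "g \<circ> Q = g"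
    using Q by (auto simp: g orthogonal_transformation_def)
  have "distr (density lborel (g \<circ> Q)) borel Q = density (distr lborel borel Q) g"
    unfolding o_def using meas by (intro density_distr[symmetric]) (simp_all add: g_def)
  then have "distr (density lborel g) borel Q = density lborel g"
    unfolding gQ distr_lborel_orthogonal_transformation[OF Q] .
  then show ?thesis
    by (simp add: gaussian_vec_def g_def)
qed

section \<open>Coordinates of a Gaussian vector and the chi-squared law\<close>

lemma vec_nth_measurable_PiM [measurable]:
  "vec_nth \<in> borel \<rightarrow>\<^sub>M (\<Pi>\<^sub>M i\<in>(UNIV::'i::finite set). borel :: real measure)"
  by (rule measurable_PiM_single') auto

lemma vec_lambda_measurable_PiM [measurable]:
  "vec_lambda \<in> (\<Pi>\<^sub>M i\<in>(UNIV::'i::finite set). borel :: real measure) \<rightarrow>\<^sub>M borel"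
proof (subst borel_measurable_euclidean_space, intro ballI)
  fix b :: "real ^ 'i" assume "b \<in> Basis"
  then obtain i where b: "b = axis i 1" by (auto simp: Basis_vec_def)
  have "(\<lambda>x. vec_lambda x \<bullet> b) = (\<lambda>x. x i)"
    by (simp add: b inner_axis)
  then show "(\<lambda>x. vec_lambda x \<bullet> b) \<in> borel_measurable (\<Pi>\<^sub>M i\<in>(UNIV::'i::finite set). borel :: real measure)"
    by simp
qed

lemma prob_space_std_normal: "prob_space std_normal_distribution"
  by (simp add: prob_space_normal_density)

lemma product_prob_space_std_normal: "product_prob_space (\<lambda>_. std_normal_distribution)"
  by (intro product_prob_spaceI prob_space_std_normal)

lemma sets_PiM_std_normal: "sets (PiM I (\<lambda>_. std_normal_distribution)) = sets (PiM I (\<lambda>_. borel))"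
  by (intro sets_PiM_cong) simp_all

text \<open>A product measure is determined by its values on boxes. There both the density and the
  indicator factor over the coordinates, so the Lebesgue integral splits into one-dimensional
  ones.\<close>

lemma distr_gaussian_vec_PiM:
  "distr gaussian_vec (\<Pi>\<^sub>M i\<in>UNIV. borel) vec_nth = (\<Pi>\<^sub>M i\<in>(UNIV::'i::finite set). std_normal_distribution)"
proof -
  interpret product_prob_space "\<lambda>_::'i. std_normal_distribution"
    by (rule product_prob_space_std_normal)
  show ?thesis
  proof (rule PiM_eqI)
    show "sets (distr gaussian_vec (\<Pi>\<^sub>M i\<in>UNIV. borel) vec_nth) = sets (\<Pi>\<^sub>M i\<in>(UNIV::'i set). std_normal_distribution)"
      by (simp add: sets_PiM_std_normal)
    fix A :: "'i \<Rightarrow> real set" assume "\<And>i. i \<in> UNIV \<Longrightarrow> A i \<in> sets std_normal_distribution"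
    then have A [measurable]: "\<And>i. A i \<in> sets borel" by simp
    define h where "h i t = ennreal (std_normal_density t) * indicator (A i) t" for i t
    have hm [measurable]: "h i \<in> borel_measurable borel" for i
      unfolding h_def by measurable
    \<comment> \<open>\<open>nn_integral_lborel_prod\<close> indexes its factors by
      \<open>Basis\<close>; \<open>i_of\<close> leads from a basis vector back to its
      coordinate.\<close>
    define i_of where "i_of b = (THE i. b = axis i (1::real))" for b :: "real ^ 'i"
    have i_of [simp]: "i_of (axis i 1) = i" for i
      unfolding i_of_def by (rule the_equality) (auto simp: axis_eq_axis)
    have Basis: "(Basis :: (real ^ 'i) set) = (\<lambda>i. axis i 1) ` UNIV"
      by (auto simp: Basis_vec_def)
    have inj: "inj (\<lambda>i::'i. axis i (1::real))"
      by (auto simp: inj_on_def axis_eq_axis)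
    have S: "{x :: real ^ 'i. \<forall>i. x $ i \<in> A i} \<in> sets borel"
      by measurable
    have "emeasure (distr gaussian_vec (\<Pi>\<^sub>M i\<in>UNIV. borel) vec_nth) (Pi\<^sub>E UNIV A) =
        emeasure gaussian_vec {x. \<forall>i. x $ i \<in> A i}"
    proof (subst emeasure_distr)
      show "Pi\<^sub>E UNIV A \<in> sets (\<Pi>\<^sub>M i\<in>UNIV. borel)"
        by (rule sets_PiM_I_finite) auto
      show "emeasure gaussian_vec (vec_nth -` Pi\<^sub>E UNIV A \<inter> space gaussian_vec) =
        emeasure gaussian_vec {x. \<forall>i. x $ i \<in> A i}"
        by (rule arg_cong[of _ _ "emeasure gaussian_vec"]) (auto simp: PiE_iff)
    qed measurable
    also have "\<dots> = (\<integral>\<^sup>+x. (\<Prod>i\<in>UNIV. ennreal (std_normal_density (x $ i))) * indicator {x. \<forall>i. x $ i \<in> A i} x \<partial>lborel)"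
      unfolding gaussian_vec_def using S by (subst emeasure_density) simp_all
    also have "\<dots> = (\<integral>\<^sup>+x. (\<Prod>b\<in>Basis. h (i_of b) (x \<bullet> b)) \<partial>lborel)"
    proof (rule nn_integral_cong)
      fix x :: "real ^ 'i"
      have "indicator {x. \<forall>i. x $ i \<in> A i} x = (\<Prod>i\<in>UNIV. indicator (A i) (x $ i) :: ennreal)"
        by (cases "\<forall>i. x $ i \<in> A i") (auto simp: indicator_def prod_zero_iff)
      then show "(\<Prod>i\<in>UNIV. ennreal (std_normal_density (x $ i))) * indicator {x. \<forall>i. x $ i \<in> A i} x
        = (\<Prod>b\<in>Basis. h (i_of b) (x \<bullet> b))"
        by (simp add: Basis prod.reindex[OF inj] h_def prod.distrib inner_axis)
    qed
    also have "\<dots> = (\<Prod>b\<in>Basis. \<integral>\<^sup>+t. h (i_of b) t \<partial>lborel)"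
      by (rule nn_integral_lborel_prod) simp_all
    also have "\<dots> = (\<Prod>i\<in>UNIV. \<integral>\<^sup>+t. h i t \<partial>lborel)"
      by (simp add: Basis prod.reindex[OF inj])
    also have "\<dots> = (\<Prod>i\<in>UNIV. emeasure std_normal_distribution (A i))"
      by (simp add: h_def emeasure_density)
    finally show "emeasure (distr gaussian_vec (\<Pi>\<^sub>M i\<in>UNIV. borel) vec_nth) (Pi\<^sub>E UNIV A) =
       (\<Prod>i\<in>UNIV. emeasure std_normal_distribution (A i))" .
  qed simp
qed

lemma gaussian_vec_eq_distr_PiM:
  "gaussian_vec = distr (\<Pi>\<^sub>M i\<in>(UNIV::'i::finite set). std_normal_distribution) borel vec_lambda"
proof -
  have "distr (distr gaussian_vec (\<Pi>\<^sub>M i\<in>(UNIV::'i set). borel) vec_nth) borel vec_lambda = gaussian_vec"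
    by (simp add: distr_distr o_def distr_id2)
  then show ?thesis
    by (simp add: distr_gaussian_vec_PiM)
qed

lemma prob_space_chi_squared: "prob_space (chi_squared n)"
  unfolding chi_squared_def
  by (intro prob_space.prob_space_distr prob_space_PiM prob_space_std_normal) measurable

text \<open>Coordinates outside \<open>K\<close> are integrated out, and an enumeration of
  \<open>K\<close> matches the remaining independent normals with those in
  \<open>chi_squared\<close>.\<close>

lemma distr_gaussian_vec_sum_squares:
  fixes K :: "'i::finite set"
  shows "distr gaussian_vec borel (\<lambda>x :: real ^ 'i. \<Sum>i\<in>K. (x $ i)\<^sup>2) = chi_squared (card K)"
proof -
  obtain h where h: "bij_betw h {..<card K} K"
    using ex_bij_betw_nat_finite[of K] by (auto simp: atLeast0LessThan)
  have "distr (\<Pi>\<^sub>M i\<in>(UNIV::'i set). std_normal_distribution) (\<Pi>\<^sub>M n\<in>{..<card K}. std_normal_distribution)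
      (\<lambda>\<omega>. \<lambda>n\<in>{..<card K}. \<omega> (h n)) = (\<Pi>\<^sub>M n\<in>{..<card K}. std_normal_distribution)"
    by (rule distr_PiM_reindex) (use h prob_space_std_normal in \<open>auto simp: bij_betw_def\<close>)
  then have "chi_squared (card K) = distr (distr (\<Pi>\<^sub>M i\<in>(UNIV::'i set). std_normal_distribution)
      (\<Pi>\<^sub>M n\<in>{..<card K}. std_normal_distribution) (\<lambda>\<omega>. \<lambda>n\<in>{..<card K}. \<omega> (h n)))
      borel (\<lambda>z. \<Sum>n<card K. (z n)\<^sup>2)"
    by (simp only: chi_squared_def)
  also have "\<dots> = distr (\<Pi>\<^sub>M i\<in>(UNIV::'i set). std_normal_distribution) borel
      (\<lambda>\<omega>. \<Sum>n<card K. (\<omega> (h n))\<^sup>2)"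
    by (subst distr_distr) (auto simp: o_def intro!: distr_cong)
  also have "\<dots> = distr (distr gaussian_vec (\<Pi>\<^sub>M i\<in>(UNIV::'i set). borel) vec_nth)
      borel (\<lambda>\<omega>. \<Sum>n<card K. (\<omega> (h n))\<^sup>2)"
    by (simp only: distr_gaussian_vec_PiM)
  also have "\<dots> = distr gaussian_vec borel (\<lambda>x :: real ^ 'i. \<Sum>n<card K. (x $ (h n))\<^sup>2)"
    by (subst distr_distr) (auto simp: o_def)
  also have "(\<lambda>x :: real ^ 'i. \<Sum>n<card K. (x $ (h n))\<^sup>2) = (\<lambda>x. \<Sum>i\<in>K. (x $ i)\<^sup>2)"
    using sum.reindex_bij_betw[OF h] by (auto simp: fun_eq_iff)
  finally show ?thesis ..
qed

section \<open>Orthonormal frames and projections of Gaussian vectors\<close>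

text \<open>Orthonormal bases of \<open>W\<close> and of its orthogonal complement together have
  \<open>CARD('i)\<close> elements, so the index type itself can enumerate them. Coordinates in this
  frame then again form a vector of the same type.\<close>

lemma exists_orthonormal_family_subspace:
  fixes W :: "(real ^ 'i::finite) set"
  assumes W: "subspace W"
  obtains b :: "'i \<Rightarrow> real ^ 'i" and K where "\<And>i j. b i \<bullet> b j = (if i = j then 1 else 0)"
    "b ` K \<subseteq> W" "card K = dim W"
proof -
  obtain B where B: "B \<subseteq> W" "pairwise orthogonal B" "\<And>x. x \<in> B \<Longrightarrow> norm x = 1"
    "independent B" "card B = dim W" "span B = W"
    using orthonormal_basis_subspace[OF W] by metis
  define V where "V = {y \<in> UNIV. \<forall>x\<in>W. orthogonal x y}"
  have V: "subspace V"
    by (auto simp: V_def subspace_def orthogonal_def inner_right_distrib)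
  obtain C where C: "C \<subseteq> V" "pairwise orthogonal C" "\<And>x. x \<in> C \<Longrightarrow> norm x = 1"
    "independent C" "card C = dim V" "span C = V"
    using orthonormal_basis_subspace[OF V] by metis
  have dim: "dim V + dim W = CARD('i)"
    using dim_subspace_orthogonal_to_vectors[OF W, of UNIV] by (simp add: V_def)
  have fin: "finite B" "finite C"
    using B(4) C(4) by (simp_all add: independent_imp_finite)
  have "B \<inter> C = {}"
  proof (rule ccontr)
    assume "B \<inter> C \<noteq> {}"
    then obtain x where "x \<in> B" "x \<in> C" by auto
    then have "orthogonal x x" using B(1) C(1) by (auto simp: V_def)
    then show False using B(3)[OF \<open>x \<in> B\<close>] by (simp add: orthogonal_self)
  qed
  then have "card (B \<union> C) = CARD('i)"
    using fin dim B(5) C(5) by (simp add: card_Un_disjoint)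
  then obtain b where b: "bij_betw b (UNIV :: 'i set) (B \<union> C)"
    using finite_same_card_bij[of "UNIV :: 'i set" "B \<union> C"] fin by auto
  have orth: "orthogonal x y" if "x \<in> B \<union> C" "y \<in> B \<union> C" "x \<noteq> y" for x y
    using that B(1,2) C(1,2) by (auto simp: V_def pairwise_def orthogonal_commute subset_iff)
  have inj: "inj b" and range: "b i \<in> B \<union> C" for i
    using b by (auto simp: bij_betw_def)
  show thesis
  proof
    show "b i \<bullet> b j = (if i = j then 1 else 0)" for i j
      using orth[OF range[of i] range[of j]] B(3) C(3) range[of i] inj
      by (auto simp: orthogonal_def inj_eq norm_eq_1)
    show "b ` (b -` B) \<subseteq> W" using B(1) by auto
    have "b ` (b -` B) = B"
      using b by (auto simp: bij_betw_def image_iff)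
    then show "card (b -` B) = dim W"
      using card_image[of b "b -` B"] inj B(5) by (simp add: inj_on_subset)
  qed
qed

text \<open>\<open>q\<close> is the orthogonal projection onto a \<open>k\<close>-dimensional subspace of \<open>W\<close>.\<close>

lemma gaussian_vec_projection_chi_squared:
  fixes W :: "(real ^ 'i::finite) set"
  assumes W: "subspace W" and k: "k \<le> dim W"
  obtains q :: "real ^ 'i \<Rightarrow> real ^ 'i" where "\<And>x. q x \<in> W" "\<And>x. x \<bullet> q x = (norm (q x))\<^sup>2"
    "q \<in> borel_measurable borel" "distr gaussian_vec borel (\<lambda>x. (norm (q x))\<^sup>2) = chi_squared k"
proof -
  obtain b :: "'i \<Rightarrow> real ^ 'i" and K0 where b: "\<And>i j. b i \<bullet> b j = (if i = j then 1 else 0)"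
    and K0: "b ` K0 \<subseteq> W" "card K0 = dim W"
    by (rule exists_orthonormal_family_subspace[OF W]) blast
  \<comment> \<open>The dimension of \<open>W\<close> may exceed \<open>k\<close>; keeping exactly
    \<open>k\<close> frame vectors gives exactly \<open>k\<close> degrees of freedom.\<close>
  obtain K where K: "K \<subseteq> K0" "card K = k"
    using k K0(2) by (metis obtain_subset_with_card_n)
  \<comment> \<open>\<open>Q\<close> takes coordinates in the frame and \<open>R\<close> rebuilds
    the vector. Orthonormality shows directly that \<open>R\<close> is an isometry with
    \<open>Q (R x) = x\<close>, so \<open>Q\<close> is orthogonal as the inverse of
    \<open>R\<close>.\<close>
  define Q :: "real ^ 'i \<Rightarrow> real ^ 'i" where "Q x = (\<chi> i. b i \<bullet> x)" for x
  define R :: "real ^ 'i \<Rightarrow> real ^ 'i" where "R x = (\<Sum>i\<in>UNIV. x $ i *\<^sub>R b i)" for x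
  define q where "q x = (\<Sum>i\<in>K. (b i \<bullet> x) *\<^sub>R b i)" for x
  have linQ: "linear Q" and linR: "linear R"
    by (auto simp: Q_def R_def linear_iff vec_eq_iff inner_right_distrib scaleR_add_left
        sum.distrib scaleR_sum_right)
  have normR: "norm (R x) = norm x" for x
  proof -
    have "R x \<bullet> R x = (\<Sum>i\<in>UNIV. x $ i * x $ i)"
      by (simp add: R_def inner_sum_left inner_sum_right b if_distrib cong: if_cong)
    then show ?thesis
      by (simp add: norm_eq_sqrt_inner inner_vec_def)
  qed
  have "orthogonal_transformation R"
    by (simp add: orthogonal_transformation linR normR)
  moreover have QR: "Q (R x) = x" for x
    by (simp add: Q_def R_def inner_sum_right b vec_eq_iff if_distrib cong: if_cong)
  ultimately have "Q = inv R" 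
    by (metis inv_equality orthogonal_transformation_bij bij_is_surj surj_f_inv_f)
  then have Q: "orthogonal_transformation Q"
    using \<open>orthogonal_transformation R\<close> orthogonal_transformation_inv by auto
  have normq: "(norm (q x))\<^sup>2 = (\<Sum>i\<in>K. (Q x $ i)\<^sup>2)" for x
    unfolding dot_square_norm[symmetric]
    by (simp add: q_def Q_def inner_sum_left inner_sum_right b if_distrib
        power2_eq_square cong: if_cong)
  show thesis
  proof
    show "q x \<in> W" for x
      unfolding q_def using K(1) K0(1) by (intro subspace_sum subspace_scale W) auto
    show "x \<bullet> q x = (norm (q x))\<^sup>2" for x
      by (simp add: normq) (simp add: q_def Q_def inner_sum_right power2_eq_square inner_commute)
    show "q \<in> borel_measurable borel"
      unfolding q_def by measurable
    have meas: "Q \<in> borel_measurable borel"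
      by (rule borel_measurable_orthogonal_transformation[OF Q])
    have "distr gaussian_vec borel (\<lambda>x. (norm (q x))\<^sup>2) =
      distr (distr gaussian_vec borel Q) borel (\<lambda>x. \<Sum>i\<in>K. (x $ i)\<^sup>2)"
      using meas by (subst distr_distr) (auto simp: normq o_def)
    also have "\<dots> = chi_squared k"
      by (simp add: distr_gaussian_vec_orthogonal_transformation[OF Q] distr_gaussian_vec_sum_squares K(2))
    finally show "distr gaussian_vec borel (\<lambda>x. (norm (q x))\<^sup>2) = chi_squared k" .
  qed
qed

section \<open>The success event and a sufficient condition for it\<close>

text \<open>Gaussian matrices are handled as Gaussian vectors indexed by pairs, so that rotation invariance
  of \<open>gaussian_vec\<close> applies both to whole matrices and to single rows.\<close>

definition matrix_of_entries :: "real ^ ('n::finite \<times> 'm::finite) \<Rightarrow> real ^ 'm ^ 'n" where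
  "matrix_of_entries a = (\<chi> i j. a $ (i, j))"

text \<open>The feasible box is compact, and projecting a closed set of pairs along a compact factor
  gives a closed set. This supplies the measurability of the success event.\<close>

lemma closed_RP_successful:
  fixes f :: "real ^ 'n::finite \<Rightarrow> real"
  assumes f: "continuous_on UNIV f"
  shows "closed {a. RP_successful f (matrix_of_entries a :: real ^ 'm::finite ^ 'n) \<delta>}"
proof -
  have "reduced_feasible \<delta> = cbox (\<chi> j::'m. - \<delta>) (\<chi> j. \<delta>) "
    by (auto simp: reduced_feasible_def mem_box_cart)
  then have comp: "compact (reduced_feasible \<delta> :: (real ^ 'm) set)"
    by simp
  define h :: "(real ^ 'm) \<times> (real ^ ('n \<times> 'm)) \<Rightarrow> real ^ 'n" where
    "h p = matrix_of_entries (snd p) *v fst p" for p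
  have "continuous_on UNIV h"
    unfolding h_def matrix_of_entries_def matrix_vector_mult_def
    by (simp add: continuous_on_vec_lambda continuous_intros)
  then have "continuous_on UNIV (\<lambda>p. f (h p))"
    by (rule continuous_on_compose2[OF f]) auto
  then have "closed {p. f (h p) = global_min f}"
    by (intro closed_Collect_eq) (auto intro!: continuous_intros)
  from closed_compact_projection[OF comp this] show ?thesis
    by (simp add: RP_successful_def h_def Bex_def)
qed

text \<open>The first two conditions on \<open>y\<close> treat the part of \<open>T\<close>
  orthogonal to the axis and the axis itself. Together they place
  \<open>B *v y - c *\<^sub>R axis i\<^sub>0 1\<close> in \<open>T\<^sup>\<bottom>\<close>, so
  \<open>f\<close> agrees at both points. The norm bound suffices because the Euclidean ball of
  radius \<open>\<delta>\<close> lies in the box.\<close>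

lemma RP_successful_if_preimage:
  fixes f :: "real ^ 'n::finite \<Rightarrow> real" and B :: "real ^ 'm::finite ^ 'n"
  assumes T: "subspace T" "axis i\<^sub>0 1 \<in> T"
    and inv: "\<And>x z. x \<in> T \<Longrightarrow> z \<in> T\<^sup>\<bottom> \<Longrightarrow> f (x + z) = f x"
    and opt: "f (c *\<^sub>R axis i\<^sub>0 1) = global_min f"
    and y: "\<And>u. u \<in> T \<Longrightarrow> u $ i\<^sub>0 = 0 \<Longrightarrow> u \<bullet> (B *v y) = 0" "B $ i\<^sub>0 \<bullet> y = c" "norm y \<le> \<delta>"
  shows "RP_successful f B \<delta>"
proof -
  define z where "z = B *v y - c *\<^sub>R axis i\<^sub>0 1"
  have By: "(B *v y) $ i\<^sub>0 = c"
    using y(2) by (simp add: matrix_vector_mult_def inner_vec_def)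
  have "t \<bullet> z = 0" if "t \<in> T" for t
  proof -
    define u where "u = t - (t $ i\<^sub>0) *\<^sub>R axis i\<^sub>0 1"
    have "u \<in> T" "u $ i\<^sub>0 = 0"
      using T that by (auto simp: u_def intro: subspace_diff subspace_scale)
    then have "u \<bullet> (B *v y) = 0" by (rule y(1))
    then show ?thesis
      by (simp add: u_def z_def inner_diff_left inner_diff_right inner_axis inner_axis' By)
  qed
  then have "z \<in> T\<^sup>\<bottom>"
    by (simp add: orthogonal_comp_def orthogonal_def)
  then have "f (c *\<^sub>R axis i\<^sub>0 1 + z) = f (c *\<^sub>R axis i\<^sub>0 1)"
    using T by (intro inv subspace_scale)
  then have "f (B *v y) = global_min f"
    using opt by (simp add: z_def)
  moreover have "y \<in> reduced_feasible \<delta>"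
  proof -
    have "\<bar>y $ j\<bar> \<le> \<delta>" for j
      using component_le_norm_cart[of y j] y(3) by linarith
    then show ?thesis by (auto simp: reduced_feasible_def abs_le_iff minus_le_iff)
  qed
  ultimately show ?thesis
    by (auto simp: RP_successful_def)
qed

text \<open>\<open>W\<close> is the orthogonal complement of the image of \<open>T0\<close> under
  \<open>transpose B\<close>. The \<open>+ 1\<close> arises because \<open>T0\<close> is
  \<open>T\<close> without the axis direction. A linear map cannot raise the dimension, which gives
  the inequality for every \<open>B\<close>, of whatever rank.\<close>

lemma dim_annihilator_rows:
  fixes B :: "real ^ 'm::finite ^ 'n::finite"
  assumes T: "subspace T" "axis i\<^sub>0 1 \<in> T" "dim T \<le> CARD('m)"
  defines "W \<equiv> {y. \<forall>u\<in>T. u $ i\<^sub>0 = 0 \<longrightarrow> u \<bullet> (B *v y) = 0}"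
  shows "subspace W" "CARD('m) - dim T + 1 \<le> dim W"
proof -
  show "subspace W"
    by (auto simp: W_def subspace_def matrix_vector_right_distrib inner_add_right
        matrix_vector_mult_scaleR)
  let ?e = "axis i\<^sub>0 1 :: real ^ 'n"
  define T0 where "T0 = {u\<in>T. \<forall>x\<in>span {?e}. orthogonal x u}"
  have T0: "T0 = {u\<in>T. u $ i\<^sub>0 = 0}"
    by (auto simp: T0_def span_singleton orthogonal_def inner_axis')
  have sub: "subspace T0"
    unfolding T0 using T(1) by (auto simp: subspace_def)
  have "span {?e} \<subseteq> T"
    using T by (simp add: span_minimal)
  then have dimT: "dim T0 + 1 = dim T"
    using dim_subspace_orthogonal_to_vectors[OF subspace_span T(1), of "{?e}"]
    by (simp add: T0_def dim_singleton axis_eq_0_iff)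
  define L :: "real ^ 'n \<Rightarrow> real ^ 'm" where "L u = transpose B *v u" for u
  have L: "linear L"
    unfolding L_def by (rule matrix_vector_mul_linear)
  have "W = {y \<in> UNIV. \<forall>w\<in>L ` T0. orthogonal w y}"
    by (auto simp: W_def T0 L_def orthogonal_def dot_lmul_matrix)
  then have "dim W + dim (L ` T0) = CARD('m)"
    using dim_subspace_orthogonal_to_vectors[OF linear_subspace_image[OF L sub] subspace_UNIV] by simp
  moreover have "dim (L ` T0) \<le> dim T0"
    by (rule dim_image_le[OF L])
  ultimately show "CARD('m) - dim T + 1 \<le> dim W"
    using dimT T(3) by linarith
qed

section \<open>The bound for a minimizer on a coordinate axis, conditionally on the other
  rows\<close>

lemma gaussian_RP_successful_ge:
  fixes f :: "real ^ 'n::finite \<Rightarrow> real"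
  assumes f: "continuous_on UNIV f"
    and T: "subspace T" "axis i\<^sub>0 1 \<in> T"
    and inv: "\<And>x z. x \<in> T \<Longrightarrow> z \<in> T\<^sup>\<bottom> \<Longrightarrow> f (x + z) = f x"
    and opt: "f (c *\<^sub>R axis i\<^sub>0 1) = global_min f"
    and "c \<noteq> 0" "\<delta> > 0" "dim T \<le> CARD('m)"
  shows "emeasure (chi_squared (CARD('m::finite) - dim T + 1)) {t. t \<ge> c\<^sup>2 / \<delta>\<^sup>2} \<le>
    emeasure gaussian_vec {a. RP_successful f (matrix_of_entries a :: real ^ 'm ^ 'n) \<delta>}"
proof -
  define S where "S = {a. RP_successful f (matrix_of_entries a :: real ^ 'm ^ 'n) \<delta>}"
  have S [measurable]: "S \<in> sets borel"
    unfolding S_def by (intro borel_closed closed_RP_successful f)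
  define k where "k = CARD('m) - dim T + 1"
  \<comment> \<open>\<open>I\<close> indexes the entries of row \<open>i\<^sub>0\<close>; Fubini
    along \<open>- I \<union> I\<close> integrates over this row with the other rows fixed.\<close>
  define I where "I = {i\<^sub>0} \<times> (UNIV :: 'm set)"
  interpret product_prob_space "\<lambda>_::'n \<times> 'm. std_normal_distribution"
    by (rule product_prob_space_std_normal)
  have Un: "- I \<union> I = UNIV" "- I \<inter> I = {}" by auto
  define ind :: "('n \<times> 'm \<Rightarrow> real) \<Rightarrow> ennreal" where "ind \<omega> = indicator S (vec_lambda \<omega>)" for \<omega>
  have ind: "ind \<in> borel_measurable (PiM UNIV (\<lambda>_. std_normal_distribution))"
    unfolding ind_def by (simp cong: measurable_cong_sets)
  have "emeasure gaussian_vec S = (\<integral>\<^sup>+a. indicator S a \<partial>gaussian_vec)"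
    by simp
  also have "\<dots> = (\<integral>\<^sup>+\<omega>. ind \<omega> \<partial>PiM (- I \<union> I) (\<lambda>_. std_normal_distribution))"
    unfolding gaussian_vec_eq_distr_PiM ind_def Un
    by (subst nn_integral_distr) (simp_all cong: measurable_cong_sets)
  also have "\<dots> = (\<integral>\<^sup>+z. (\<integral>\<^sup>+x. ind (merge (- I) I (z, x)) \<partial>PiM I (\<lambda>_. std_normal_distribution))
      \<partial>PiM (- I) (\<lambda>_. std_normal_distribution))"
    by (rule product_nn_integral_fold) (use Un ind in auto)
  finally have eq: "emeasure gaussian_vec S =
    (\<integral>\<^sup>+z. (\<integral>\<^sup>+x. ind (merge (- I) I (z, x)) \<partial>PiM I (\<lambda>_. std_normal_distribution))
      \<partial>PiM (- I) (\<lambda>_. std_normal_distribution))" .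
  have "(\<integral>\<^sup>+z. emeasure (chi_squared k) {t. t \<ge> c\<^sup>2 / \<delta>\<^sup>2} \<partial>PiM (- I) (\<lambda>_. std_normal_distribution))
    \<le> emeasure gaussian_vec S"
    unfolding eq
  \<comment> \<open>The lower bound is the same constant for every \<open>z\<close>, so
    \<open>W\<close> and \<open>q\<close> can be chosen afresh for each \<open>z\<close>.\<close>
  proof (rule nn_integral_mono)
    fix z :: "'n \<times> 'm \<Rightarrow> real"
    \<comment> \<open>The zero in row \<open>i\<^sub>0\<close> is a placeholder: \<open>W\<close>
      tests only vectors \<open>u\<close> with \<open>u $ i\<^sub>0 = 0\<close>, so it depends on
      \<open>z\<close> alone.\<close>
    define B where "B = (\<chi> i j. if i = i\<^sub>0 then 0 else z (i, j))"
    define W where "W = {y. \<forall>u\<in>T. u $ i\<^sub>0 = 0 \<longrightarrow> u \<bullet> (B *v y) = 0}"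
    have W: "subspace W" "k \<le> dim W"
      unfolding W_def k_def by (rule dim_annihilator_rows[OF T \<open>dim T \<le> CARD('m)\<close>])+
    obtain q where q: "\<And>x. q x \<in> W" "\<And>x. x \<bullet> q x = (norm (q x))\<^sup>2"
      "q \<in> borel_measurable borel" "distr gaussian_vec borel (\<lambda>x. (norm (q x))\<^sup>2) = chi_squared k"
      by (rule gaussian_vec_projection_chi_squared[OF W]) blast
    note [measurable] = q(3)
    have success: "ind (merge (- I) I (z, \<omega>)) = 1"
      if "c\<^sup>2 / \<delta>\<^sup>2 \<le> (norm (q (\<chi> j. \<omega> (i\<^sub>0, j))))\<^sup>2" for \<omega>
    proof -
      define x where "x = (\<chi> j. \<omega> (i\<^sub>0, j))"
      define A :: "real ^ 'm ^ 'n" where "A = matrix_of_entries (vec_lambda (merge (- I) I (z, \<omega>)))"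
      \<comment> \<open>As \<open>x \<bullet> q x = (norm (q x))\<^sup>2\<close>, this scaling gives
        \<open>x \<bullet> y = c\<close>, and the norm of \<open>y\<close> is
        \<open>\<bar>c\<bar> / norm (q x)\<close>.\<close>
      define y where "y = (c / (norm (q x))\<^sup>2) *\<^sub>R q x"
      have pos: "0 < c\<^sup>2 / \<delta>\<^sup>2" using \<open>c \<noteq> 0\<close> \<open>\<delta> > 0\<close> by simp
      have qx: "c\<^sup>2 / \<delta>\<^sup>2 \<le> (norm (q x))\<^sup>2" using that by (simp add: x_def)
      then have nz: "0 < norm (q x)" using pos by (cases \<open>q x = 0\<close>) auto
      have A0: "A $ i\<^sub>0 = x"
        by (simp add: A_def matrix_of_entries_def x_def merge_def I_def vec_eq_iff)
      have A1: "A $ i = B $ i" if "i \<noteq> i\<^sub>0" for i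
        using that by (simp add: A_def matrix_of_entries_def B_def merge_def I_def vec_eq_iff)
      have "RP_successful f A \<delta>"
      proof (rule RP_successful_if_preimage[OF T inv opt])
        fix u assume u: "u \<in> T" "u $ i\<^sub>0 = 0"
        have "u \<bullet> (A *v y) = (\<Sum>i\<in>UNIV. u $ i * (A $ i \<bullet> y))"
          by (simp add: inner_vec_def matrix_vector_mult_def)
        \<comment> \<open>\<open>A\<close> and \<open>B\<close> differ only in row
          \<open>i\<^sub>0\<close>, whose coefficient \<open>u $ i\<^sub>0\<close> vanishes.\<close>
        also have "\<dots> = (\<Sum>i\<in>UNIV. u $ i * (B $ i \<bullet> y))"
        proof (rule sum.cong)
          show "u $ i * (A $ i \<bullet> y) = u $ i * (B $ i \<bullet> y)" for i
            by (cases "i = i\<^sub>0") (simp_all add: A1 u)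
        qed simp
        also have "\<dots> = u \<bullet> (B *v y)"
          by (simp add: inner_vec_def matrix_vector_mult_def)
        also have "\<dots> = 0"
          using q(1)[of x] u by (simp add: W_def y_def matrix_vector_mult_scaleR)
        finally show "u \<bullet> (A *v y) = 0" .
      next
        show "A $ i\<^sub>0 \<bullet> y = c"
          using nz by (simp add: A0 y_def q(2))
        have "\<bar>c\<bar> \<le> \<delta> * norm (q x)"
          using qx \<open>\<delta> > 0\<close> by (simp add: divide_le_eq abs_le_square_iff[symmetric] power_mult_distrib[symmetric] mult.commute)
        then show "norm y \<le> \<delta>"
          using nz by (simp add: y_def power2_eq_square divide_le_eq)
      qed auto
      then show ?thesis
        by (simp add: ind_def S_def A_def)
    qed
    define row :: "('n \<times> 'm \<Rightarrow> real) \<Rightarrow> real ^ 'm" where "row \<omega> = (\<chi> j. \<omega> (i\<^sub>0, j))" for \<omega>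
    have coords: "(\<lambda>\<omega> j. \<omega> (i\<^sub>0, j)) \<in> PiM I (\<lambda>_. std_normal_distribution) \<rightarrow>\<^sub>M
        PiM UNIV (\<lambda>_::'m. std_normal_distribution)"
      by (rule measurable_PiM_single') (auto simp: I_def)
    then have row_meas [measurable]: "row \<in> borel_measurable (PiM I (\<lambda>_. std_normal_distribution))"
      unfolding row_def[abs_def]
      by (rule measurable_compose) (simp cong: measurable_cong_sets)
    \<comment> \<open>Indexing \<open>I\<close> by columns turns the product law of the row entries
      into \<open>gaussian_vec\<close>, for which the law of \<open>(norm (q x))\<^sup>2\<close> is
      known.\<close>
    have row: "distr (PiM I (\<lambda>_. std_normal_distribution)) borel row = gaussian_vec"
    proof -
      have "distr (PiM I (\<lambda>_. std_normal_distribution)) (PiM UNIV (\<lambda>_::'m. std_normal_distribution))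
          (\<lambda>\<omega>. \<lambda>j\<in>UNIV. \<omega> (i\<^sub>0, j)) = PiM UNIV (\<lambda>_. std_normal_distribution)"
        by (rule distr_PiM_reindex) (auto simp: I_def inj_on_def prob_space_std_normal)
      then have "gaussian_vec = distr (distr (PiM I (\<lambda>_. std_normal_distribution)) (PiM UNIV (\<lambda>_::'m. std_normal_distribution))
          (\<lambda>\<omega>. \<lambda>j\<in>UNIV. \<omega> (i\<^sub>0, j))) borel vec_lambda"
        by (simp only: gaussian_vec_eq_distr_PiM)
      also have "\<dots> = distr (PiM I (\<lambda>_. std_normal_distribution)) borel row"
        using coords by (subst distr_distr) (auto simp: o_def row_def[abs_def] restrict_UNIV cong: measurable_cong_sets)
      finally show ?thesis ..
    qed
    have "emeasure (chi_squared k) {t. t \<ge> c\<^sup>2 / \<delta>\<^sup>2} =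
      emeasure gaussian_vec {x. c\<^sup>2 / \<delta>\<^sup>2 \<le> (norm (q x))\<^sup>2}"
      unfolding q(4)[symmetric] by (subst emeasure_distr) (auto simp: vimage_def)
    also have "\<dots> = emeasure (PiM I (\<lambda>_. std_normal_distribution))
        {\<omega>\<in>space (PiM I (\<lambda>_. std_normal_distribution)). c\<^sup>2 / \<delta>\<^sup>2 \<le> (norm (q (row \<omega>)))\<^sup>2}"
      unfolding row[symmetric] by (subst emeasure_distr) (auto intro!: arg_cong2[of _ _ _ _ emeasure])
    also have "\<dots> = (\<integral>\<^sup>+\<omega>. indicator {\<omega>\<in>space (PiM I (\<lambda>_. std_normal_distribution)). c\<^sup>2 / \<delta>\<^sup>2 \<le> (norm (q (row \<omega>)))\<^sup>2} \<omega>
        \<partial>PiM I (\<lambda>_. std_normal_distribution))"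
      by (rule nn_integral_indicator[symmetric]) measurable
    \<comment> \<open>By \<open>success\<close> the right integrand is 1 wherever the indicator is
      1; any further successes are discarded.\<close>
    also have "\<dots> \<le> (\<integral>\<^sup>+\<omega>. ind (merge (- I) I (z, \<omega>)) \<partial>PiM I (\<lambda>_. std_normal_distribution))"
      by (rule nn_integral_mono) (use success in \<open>auto simp: row_def indicator_def\<close>)
    finally show "emeasure (chi_squared k) {t. t \<ge> c\<^sup>2 / \<delta>\<^sup>2} \<le>
      (\<integral>\<^sup>+\<omega>. ind (merge (- I) I (z, \<omega>)) \<partial>PiM I (\<lambda>_. std_normal_distribution))" .
  qed
  moreover have "(\<integral>\<^sup>+z. emeasure (chi_squared k) {t. t \<ge> c\<^sup>2 / \<delta>\<^sup>2} \<partial>PiM (- I) (\<lambda>_. std_normal_distribution)) =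
      emeasure (chi_squared k) {t. t \<ge> c\<^sup>2 / \<delta>\<^sup>2}"
    by (simp add: prob_space.emeasure_space_1[OF prob_space_PiM] prob_space_std_normal)
  ultimately show ?thesis by (simp add: S_def k_def)
qed

section \<open>The law of the random matrix, rotation of its columns, and least-norm
  minimizers\<close>

text \<open>Independence makes the joint law of the entries a product of normal laws. Probabilities
  on \<open>M\<close> can thus be computed with \<open>gaussian_vec\<close>.\<close>

lemma (in prob_space) distr_gaussian_matrix:
  fixes A :: "'a \<Rightarrow> real ^ 'm::finite ^ 'n::finite"
  assumes "gaussian_matrix A"
  shows "(\<lambda>\<omega>. \<chi> p. A \<omega> $ fst p $ snd p) \<in> borel_measurable M"
    and "distr M borel (\<lambda>\<omega>. \<chi> p. A \<omega> $ fst p $ snd p) = gaussian_vec"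
proof -
  define X where "X = (\<lambda>p \<omega>. A \<omega> $ fst p $ snd p)"
  have indep: "indep_vars (\<lambda>_. borel) X UNIV"
    using assms by (simp add: gaussian_matrix_def X_def case_prod_unfold)
  have distr: "distributed M lborel (X p) std_normal_density" for p
    using assms by (simp add: gaussian_matrix_def X_def)
  have [measurable]: "X p \<in> borel_measurable M" for p
    using distributed_measurable[OF distr] by simp
  have Xp: "distr M borel (X p) = std_normal_distribution" for p
    using distributed_distr_eq_density[OF distr[of p]] by (simp cong: distr_cong)
  have m: "(\<lambda>\<omega>. \<lambda>p\<in>UNIV. X p \<omega>) \<in> M \<rightarrow>\<^sub>M PiM UNIV (\<lambda>_. borel)"
    by measurable
  have eq: "(\<lambda>\<omega>. \<chi> p. A \<omega> $ fst p $ snd p) = (\<lambda>\<omega>. vec_lambda (\<lambda>p\<in>UNIV. X p \<omega>))"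
    by (simp add: X_def restrict_UNIV)
  show "(\<lambda>\<omega>. \<chi> p. A \<omega> $ fst p $ snd p) \<in> borel_measurable M"
    unfolding eq using m by (rule measurable_compose) (rule vec_lambda_measurable_PiM)
  have "distr M (PiM UNIV (\<lambda>_. borel)) (\<lambda>\<omega>. \<lambda>p\<in>UNIV. X p \<omega>) = PiM UNIV (\<lambda>p. std_normal_distribution)"
    using indep by (subst (asm) indep_vars_iff_distr_eq_PiM) (simp_all add: Xp)
  then have "gaussian_vec = distr (distr M (PiM UNIV (\<lambda>_. borel)) (\<lambda>\<omega>. \<lambda>p\<in>UNIV. X p \<omega>)) borel vec_lambda"
    by (simp only: gaussian_vec_eq_distr_PiM)
  also have "\<dots> = distr M borel (\<lambda>\<omega>. \<chi> p. A \<omega> $ fst p $ snd p)"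
    unfolding eq using m by (subst distr_distr) (auto simp: o_def)
  finally show "distr M borel (\<lambda>\<omega>. \<chi> p. A \<omega> $ fst p $ snd p) = gaussian_vec" ..
qed

text \<open>\<open>\<Phi>\<close> applies \<open>R\<close> to each column. It is orthogonal because
  the squared norm of all entries is the sum of the squared column norms, and it commutes with
  multiplication by \<open>y\<close> because the product is a linear combination of columns.\<close>

lemma columnwise_orthogonal_transformation:
  fixes R :: "real ^ 'n::finite \<Rightarrow> real ^ 'n"
  assumes R: "orthogonal_transformation R"
  obtains \<Phi> :: "real ^ ('n \<times> 'm::finite) \<Rightarrow> real ^ ('n \<times> 'm)" where
    "orthogonal_transformation \<Phi>"
    "\<And>a y. matrix_of_entries (\<Phi> a) *v y = R (matrix_of_entries a *v y)"
proof -
  have linR: "linear R"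
    using R by (rule orthogonal_transformation_linear)
  define col :: "real ^ ('n \<times> 'm) \<Rightarrow> 'm \<Rightarrow> real ^ 'n" where "col a j = (\<chi> i. a $ (i, j))" for a j
  define \<Phi> :: "real ^ ('n \<times> 'm) \<Rightarrow> real ^ ('n \<times> 'm)" where "\<Phi> a = (\<chi> p. R (col a (snd p)) $ fst p)" for a
  have col\<Phi>: "col (\<Phi> a) j = R (col a j)" for a j
    by (simp add: col_def \<Phi>_def)
  have col_add: "col (a + b) j = col a j + col b j" and col_scale: "col (c *\<^sub>R a) j = c *\<^sub>R col a j" for a b c j
    by (simp_all add: col_def vec_eq_iff)
  have "linear \<Phi>"
    by (rule linearI) (simp_all add: \<Phi>_def col_add col_scale linear_add[OF linR] linear_scale[OF linR] vec_eq_iff)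
  moreover have inner: "a \<bullet> a = (\<Sum>j\<in>UNIV. col a j \<bullet> col a j)" for a
  proof -
    have "a \<bullet> a = (\<Sum>p\<in>UNIV \<times> UNIV. a $ p * a $ p)"
      by (simp add: inner_vec_def)
    also have "\<dots> = (\<Sum>i\<in>UNIV. \<Sum>j\<in>UNIV. a $ (i, j) * a $ (i, j))"
      by (simp add: sum.cartesian_product case_prod_unfold)
    also have "\<dots> = (\<Sum>j\<in>UNIV. \<Sum>i\<in>UNIV. a $ (i, j) * a $ (i, j))"
      by (rule sum.swap)
    finally show ?thesis by (simp add: inner_vec_def col_def)
  qed
  have "norm (\<Phi> a) = norm a" for a
    unfolding norm_eq_sqrt_inner inner col\<Phi>
    using R by (simp add: orthogonal_transformation_def)
  ultimately have "orthogonal_transformation \<Phi>"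
    by (simp add: orthogonal_transformation)
  moreover have mv: "matrix_of_entries a *v y = (\<Sum>j\<in>UNIV. y $ j *\<^sub>R col a j)" for a y
    by (simp add: matrix_of_entries_def matrix_vector_mult_def col_def vec_eq_iff mult.commute)
  have "matrix_of_entries (\<Phi> a) *v y = R (matrix_of_entries a *v y)" for a y
    by (simp add: mv col\<Phi> linear_sum[OF linR] linear_scale[OF linR])
  ultimately show thesis using that by blast
qed

text \<open>Closedness of the minimizer set gives a point nearest to the origin. Its projection to
  \<open>T\<close> is again a minimizer, so by Pythagoras the component in
  \<open>T\<^sup>\<bottom>\<close> is zero.\<close>

lemma exists_least_norm_minimizer:
  fixes f :: "'a::euclidean_space \<Rightarrow> real"
  assumes f: "continuous_on UNIV f" and min: "attains_global_min f"
    and T: "subspace T" and inv: "\<And>x z. x \<in> T \<Longrightarrow> z \<in> T\<^sup>\<bottom> \<Longrightarrow> f (x + z) = f x"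
  obtains x where "x \<in> T" "f x = global_min f"
    "min_over (global_minimizers f) (\<lambda>x. (norm x)\<^sup>2) = (norm x)\<^sup>2"
proof -
  obtain x0 where x0: "\<And>y. f x0 \<le> f y"
    using min by (auto simp: attains_global_min_def)
  have "global_min f = f x0"
    unfolding min_over_def by (rule Least_equality) (auto simp: x0)
  then have "global_minimizers f \<noteq> {}"
    by (auto simp: global_minimizers_def)
  moreover have "closed (global_minimizers f)"
    unfolding global_minimizers_def by (intro closed_Collect_eq f) auto
  ultimately obtain x where x: "x \<in> global_minimizers f"
    and le: "\<And>y. y \<in> global_minimizers f \<Longrightarrow> dist 0 x \<le> dist 0 y"
    by (metis distance_attains_inf)
  obtain y z where yz: "y \<in> span T" "\<And>w. w \<in> span T \<Longrightarrow> orthogonal z w" "x = y + z"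
    by (rule orthogonal_subspace_decomp_exists[of T x]) blast
  have y: "y \<in> T"
    using yz(1) T by (simp add: span_eq_iff[THEN iffD2])
  have "z \<in> T\<^sup>\<bottom>"
    using yz(2) by (auto simp: orthogonal_comp_def orthogonal_commute span_base)
  then have "f y = f x"
    using inv y yz(3) by simp
  then have "norm x \<le> norm y"
    using le[of y] x by (simp add: global_minimizers_def)
  moreover have "(norm x)\<^sup>2 = (norm y)\<^sup>2 + (norm z)\<^sup>2"
    using yz by (simp add: norm_add_Pythagorean orthogonal_commute)
  ultimately have "z = 0"
    using power_mono[of "norm x" "norm y" 2] by simp
  with y yz(3) have "x \<in> T" by simp
  moreover have "f x = global_min f"
    using x by (simp add: global_minimizers_def)
  moreover have "min_over (global_minimizers f) (\<lambda>x. (norm x)\<^sup>2) = (norm x)\<^sup>2"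
    unfolding min_over_def
    by (rule Least_equality) (use x le in \<open>auto intro!: power_mono\<close>)
  ultimately show thesis by (rule that)
qed

section \<open>Reduction of the general case to a minimizer on a coordinate axis\<close>

theorem theorem4p1:
  fixes f :: "real ^ 'n::finite \<Rightarrow> real"
    and d\<^sub>e :: nat
    and M :: "'w measure"
    and A :: "'w \<Rightarrow> real ^ 'm::finite ^ 'n"
    and \<delta> :: real
  assumes "continuous_on UNIV f"
    and "attains_global_min f"
    and "has_effective_dim f d\<^sub>e"
    and "d\<^sub>e \<le> CARD('m)"
    and "prob_space M"
    and "prob_space.gaussian_matrix M A"
    and "\<delta> > 0"
  shows "measure M {\<omega> \<in> space M. RP_successful f (A \<omega>) \<delta>} \<ge>
         measure (chi_squared (CARD('m) - d\<^sub>e + 1))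
           {t. t \<ge> min_over (global_minimizers f) (\<lambda>x. (norm x)\<^sup>2) / \<delta>\<^sup>2}"
proof -
  interpret prob_space M by fact
  interpret chi: prob_space "chi_squared (CARD('m) - d\<^sub>e + 1)"
    by (rule prob_space_chi_squared)
  obtain T where T: "subspace T" "dim T = d\<^sub>e"
    and inv: "\<And>x z. x \<in> T \<Longrightarrow> z \<in> T\<^sup>\<bottom> \<Longrightarrow> f (x + z) = f x"
    using assms(3) by (auto simp: has_effective_dim_def invariant_off_subspace_of_dim_def)
  obtain x where x: "x \<in> T" "f x = global_min f"
    and min_norm: "min_over (global_minimizers f) (\<lambda>x. (norm x)\<^sup>2) = (norm x)\<^sup>2"
    by (rule exists_least_norm_minimizer[OF assms(1,2) T(1) inv]) blast
  show ?thesis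
  \<comment> \<open>For \<open>x = 0\<close> there is no direction to rotate, but
    \<open>y = 0\<close> always succeeds, so the left side is 1.\<close>
  proof (cases "x = 0")
    case True
    have "(0 :: real ^ 'm) \<in> reduced_feasible \<delta>"
      using \<open>\<delta> > 0\<close> by (simp add: reduced_feasible_def)
    then have "RP_successful f (A \<omega>) \<delta>" for \<omega>
      using x(2) True by (auto simp: RP_successful_def intro!: bexI[of _ 0])
    then show ?thesis
      using chi.prob_le_1 by (simp add: prob_space)
  next
    case False
    \<comment> \<open>Any coordinate serves as the target axis of the rotation.\<close>
    obtain i\<^sub>0 :: 'n where True by blast
    define e :: "real ^ 'n" where "e = axis i\<^sub>0 1"
    obtain R where R: "orthogonal_transformation R" "R (x /\<^sub>R norm x) = e"
      by (rule orthogonal_transformation_exists_1[of "x /\<^sub>R norm x" e]) (use False in \<open>auto simp: e_def\<close>)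
    have linR: "linear R" and injR: "inj R" and bijR: "bij R"
      using R(1) by (simp_all add: orthogonal_transformation_linear orthogonal_transformation_inj
          orthogonal_transformation_bij)
    have Rx: "R x = norm x *\<^sub>R e"
      using R(2) False by (simp add: linear_scale[OF linR] field_simps flip: R(2))
    define g where "g = f \<circ> inv R"
    have gR [simp]: "g (R v) = f v" for v
      using injR by (simp add: g_def)
    have "range g = range f"
      using bij_is_surj[OF bij_imp_bij_inv[OF bijR]] by (simp only: g_def image_comp[symmetric])
    then have gmin: "global_min g = global_min f"
      by (simp add: min_over_def)
    have "linear (inv R)"
      using orthogonal_transformation_linear[OF orthogonal_transformation_inv[OF R(1)]] .
    then have "continuous_on UNIV g"
      unfolding g_def using continuous_on_subset[OF assms(1)]
      by (intro continuous_on_compose linear_continuous_on[of "inv R"])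
        (auto simp: linear_conv_bounded_linear)
    moreover have "subspace (R ` T)"
      by (rule linear_subspace_image[OF linR T(1)])
    moreover have "axis i\<^sub>0 1 \<in> R ` T"
      using x(1) T(1) R(2) by (metis e_def imageI subspace_scale)
    moreover have "g (u + w) = g u" if uw: "u \<in> R ` T" "w \<in> (R ` T)\<^sup>\<bottom>" for u w
    proof -
      obtain v where v: "v \<in> T" "u = R v" using uw(1) by blast
      obtain z where z: "w = R z" using bijR by (metis bij_pointE)
      have "z \<in> T\<^sup>\<bottom>"
        using uw(2) R(1) by (auto simp: orthogonal_comp_def orthogonal_def z orthogonal_transformation_def)
      then show ?thesis
        using inv[OF v(1)] by (simp add: v z flip: linear_add[OF linR])
    qed
    moreover have "g (norm x *\<^sub>R axis i\<^sub>0 1) = global_min g"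
      using x(2) gmin by (simp add: Rx[symmetric, unfolded e_def])
    moreover have "dim (R ` T) = d\<^sub>e"
      using dim_image_eq[OF linR] injR T(2) by (simp add: inj_on_subset)
    ultimately have chi_le: "emeasure (chi_squared (CARD('m) - d\<^sub>e + 1)) {t. t \<ge> (norm x)\<^sup>2 / \<delta>\<^sup>2} \<le>
        emeasure gaussian_vec {a. RP_successful g (matrix_of_entries a :: real ^ 'm ^ 'n) \<delta>}"
      using gaussian_RP_successful_ge[of g "R ` T" i\<^sub>0 "norm x" \<delta>, where 'm = 'm] False assms(4,7)
      by simp
    obtain \<Phi> :: "real ^ ('n \<times> 'm) \<Rightarrow> real ^ ('n \<times> 'm)" where \<Phi>: "orthogonal_transformation \<Phi>"
      "\<And>a y. matrix_of_entries (\<Phi> a) *v y = R (matrix_of_entries a *v y)"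
      using columnwise_orthogonal_transformation[OF R(1)] by blast
    have [measurable]: "\<Phi> \<in> borel_measurable borel"
      by (rule borel_measurable_orthogonal_transformation[OF \<Phi>(1)])
    \<comment> \<open>As \<open>g (R v) = f v\<close>, rotating the columns by \<open>\<Phi>\<close>
      turns success for \<open>f\<close> into success for \<open>g\<close>. Since
      \<open>\<Phi>\<close> preserves \<open>gaussian_vec\<close>, both events have the same
      probability.\<close>
    have iff: "RP_successful g (matrix_of_entries (\<Phi> a)) \<delta> \<longleftrightarrow> RP_successful f (matrix_of_entries a) \<delta>" for a
      by (simp add: RP_successful_def \<Phi>(2) gmin)
    have [measurable]: "{a. RP_successful g (matrix_of_entries a :: real ^ 'm ^ 'n) \<delta>} \<in> sets borel"
      "{a. RP_successful f (matrix_of_entries a :: real ^ 'm ^ 'n) \<delta>} \<in> sets borel"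
      using \<open>continuous_on UNIV g\<close> assms(1) by (auto intro!: borel_closed closed_RP_successful)
    let ?a = "\<lambda>\<omega>. \<chi> p. A \<omega> $ fst p $ snd p"
    have mat: "matrix_of_entries (?a \<omega>) = A \<omega>" for \<omega>
      by (simp add: matrix_of_entries_def vec_eq_iff)
    have "emeasure gaussian_vec {a. RP_successful g (matrix_of_entries a :: real ^ 'm ^ 'n) \<delta>} =
      emeasure (distr gaussian_vec borel \<Phi>) {a. RP_successful g (matrix_of_entries a :: real ^ 'm ^ 'n) \<delta>}"
      by (simp only: distr_gaussian_vec_orthogonal_transformation[OF \<Phi>(1)])
    also have "\<dots> = emeasure gaussian_vec {a. RP_successful f (matrix_of_entries a :: real ^ 'm ^ 'n) \<delta>}"
      by (subst emeasure_distr) (simp_all add: vimage_def iff)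
    also have "\<dots> = emeasure M {\<omega> \<in> space M. RP_successful f (A \<omega>) \<delta>}"
      unfolding distr_gaussian_matrix(2)[OF assms(6), symmetric]
      using distr_gaussian_matrix(1)[OF assms(6)]
      by (subst emeasure_distr) (auto simp: mat intro!: arg_cong2[of _ _ _ _ emeasure])
    finally show ?thesis
      using chi_le
      by (simp only: min_norm chi.emeasure_eq_measure emeasure_eq_measure ennreal_le_iff measure_nonneg)
  qed
qed

end
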